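(* Let $G\in\mathbf{RH}_\infty$ and let $\omega_1=\frac{\alpha}{\beta}\pi$, where $\alpha,\beta$ are positive integers with $\gcd(\alpha,\beta)=1$ and $\alpha<\beta$. (i) If $$k=\begin{cases}\psi(\omega_1,2\beta)&\text{when }\alpha\text{ is odd},\\ \psi(\omega_1,\beta)&\text{when }\alpha\text{ is even}\end{cases}$$ is positive, then there is no $M\in\mathcal{M}$ such that $\mathrm{Re}\left\{M(e^{j\omega})\left(G(e^{j\omega})+\frac1k\right)\right\}>0$ for all $\omega\in[0,\pi]$. (ii) If $k=\psi(\omega_1,2\beta)$ is positive, then there is no $M\in\mathcal{M}_{\text{odd}}$ such that $\mathrm{Re}\left\{M(e^{j\omega})\left(G(e^{j\omega})+\frac1k\right)\right\}>0$ for all $\omega\in[0,\pi]$.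
   Context: $j$ is the imaginary unit. $\mathbf{RH}_\infty$ is the set of scalar proper rational functions $G(z)$ with real coefficients all of whose poles lie in the open unit disk. For given $G$, $\omega\in\mathbb{R}$ and positive integer $b$, $$\psi(\omega,b)=\frac{-\tan(\pi/b)}{R(\omega)\tan(\pi/b)+I(\omega)},\qquad R(\omega)=\mathrm{Re}\{G(e^{j\omega})\},\quad I(\omega)=\left|\mathrm{Im}\{G(e^{j\omega})\}\right|$$ (the hypothesis that $k$ is positive includes that the denominator is nonzero). For a real two-sided sequence $h=(h_i)_{i\in\mathbb{Z}}$, $\|h\|_1=\sum_{i\in\mathbb{Z}}|h_i|$. Discrete-time LTI Zames-Falb multipliers: $\mathcal{M}$ is the set of functions on the unit circle of the form $M(e^{j\omega})=1-H(e^{j\omega})$, $H(e^{j\omega})=\sum_{i\in\mathbb{Z}}h_ie^{-j\omega i}$, where $h$ is a real sequence with $h_0=0$, $h_i\ge 0$ for all $i$ and $\|h\|_1\le 1$. $\mathcal{M}_{\text{odd}}$ is the set of such functions where $h$ is a real sequence with $h_0=0$ and $\|h\|_1\le 1$ (no sign condition). *)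

theory Defs
  imports "HOL-Complex_Analysis.Complex_Analysis"
begin

text \<open>
  Coprimality of numerator and denominator ensures that the total function \<^term>\<open>G\<close> takes
  the value of the rational function at every point that is not a pole.
\<close>

definition RH_inf :: "(complex \<Rightarrow> complex) set" where
  "RH_inf = {G. \<exists>p q :: real poly.
      q \<noteq> 0 \<and> coprime p q \<and> degree p \<le> degree q \<and>
      (\<forall>z. G z = poly (map_poly complex_of_real p) z / poly (map_poly complex_of_real q) z) \<and>
      (\<forall>z. is_pole G z \<longrightarrow> cmod z < 1)}"

text \<open>
  If the denominator vanishes, the quotient is \<^term>\<open>0::real\<close>, so positivity of this
  expression includes that the denominator is nonzero.
\<close>

definition psi :: "(complex \<Rightarrow> complex) \<Rightarrow> real \<Rightarrow> nat \<Rightarrow> real" where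
  "psi G \<omega> b = - tan (pi / real b) /
     (Re (G (cis \<omega>)) * tan (pi / real b) + \<bar>Im (G (cis \<omega>))\<bar>)"

definition l1_norm_le_1 :: "(int \<Rightarrow> real) \<Rightarrow> bool" where
  "l1_norm_le_1 h \<longleftrightarrow>
     (\<lambda>i. \<bar>h i\<bar>) summable_on UNIV \<and> (\<Sum>\<^sub>\<infinity>i. \<bar>h i\<bar>) \<le> 1"

definition fourier :: "(int \<Rightarrow> real) \<Rightarrow> real \<Rightarrow> complex" where
  "fourier h \<omega> = (\<Sum>\<^sub>\<infinity>i. complex_of_real (h i) * cis (- \<omega> * real_of_int i))"

text \<open>
  Functions on the unit circle are total functions on the complex plane whose values
  off the circle are unconstrained.
\<close>

definition ZF :: "(complex \<Rightarrow> complex) set" where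
  "ZF = {M. \<exists>h. h 0 = 0 \<and> (\<forall>i. h i \<ge> 0) \<and> l1_norm_le_1 h \<and>
      (\<forall>\<omega>. M (cis \<omega>) = 1 - fourier h \<omega>)}"

definition ZF_odd :: "(complex \<Rightarrow> complex) set" where
  "ZF_odd = {M. \<exists>h. h 0 = 0 \<and> l1_norm_le_1 h \<and>
      (\<forall>\<omega>. M (cis \<omega>) = 1 - fourier h \<omega>)}"

end

theory Submission
  imports Defs
begin

text \<open>
  Put \<open>\<theta> = \<pi>/b\<close> and let \<open>\<phi> = \<plusminus>\<theta>\<close>, with the sign of \<open>Im G(e\<^sup>j\<^sup>\<omega>)\<close>. The gain \<open>k = \<psi>(\<omega>, b)\<close> is
  chosen so that \<open>G(e\<^sup>j\<^sup>\<omega>) + 1/k\<close> is a nonpositive multiple of \<open>e\<^sup>-\<^sup>j\<^sup>\<phi>\<close>. On the other hand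
  \<open>Re (e\<^sup>-\<^sup>j\<^sup>\<phi> M(e\<^sup>j\<^sup>\<omega>)) = cos \<theta> - \<Sum>\<^sub>i h\<^sub>i cos (\<omega>i + \<phi>)\<close>. At \<open>\<omega> = \<pi>\<alpha>/\<beta>\<close> all the angles \<open>\<omega>i + \<phi>\<close>
  are odd multiples of \<open>\<theta>\<close>, and among these the cosine (for \<open>b = 2\<beta>\<close> also its absolute value) is
  largest at \<open>\<theta>\<close> itself. Hence the real part is nonnegative for every multiplier and the
  frequency condition fails at this single frequency.
\<close>

text \<open>Modulo \<open>2 * int b\<close> only residues \<open>r\<close> from \<open>1\<close> to
  \<open>2 * b - 1\<close> remain. Cosine decreases on \<open>[0, pi]\<close>, which settles
  \<open>r \<le> b\<close>; symmetry about \<open>pi\<close> handles the rest.\<close>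

lemma cos_multiple_le_cos:
  fixes m :: int and b :: nat
  assumes "b > 0" and "\<not> 2 * int b dvd m"
  shows "cos (of_int m * (pi / real b)) \<le> cos (pi / real b)"
proof -
  define r where "r = m mod (2 * int b)"
  define q where "q = m div (2 * int b)"
  have m: "m = r + 2 * int b * q"
    by (simp add: r_def q_def)
  have "2 * int b > 0"
    using assms(1) by simp
  then have "0 \<le> r" "r < 2 * int b"
    unfolding r_def by (rule pos_mod_sign, rule pos_mod_bound)
  moreover have "r \<noteq> 0"
    using assms(2) unfolding r_def dvd_eq_mod_eq_0 .
  ultimately have r: "1 \<le> r" "r < 2 * int b"
    by linarith+
  have mono: "cos (of_int n * (pi / real b)) \<le> cos (pi / real b)" if "1 \<le> n" "n \<le> int b" for n
  proof (rule cos_monotone_0_pi_le)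
    have n: "1 \<le> real_of_int n" "real_of_int n \<le> real b"
      using that by linarith+
    show "pi / real b \<le> of_int n * (pi / real b)"
      using mult_right_mono[OF n(1), of "pi / real b"] by simp
    show "of_int n * (pi / real b) \<le> pi"
      using mult_right_mono[OF n(2), of "pi / real b"] assms(1) by simp
  qed simp
  have "of_int m * (pi / real b) = of_int r * (pi / real b) + 2 * pi * of_int q"
    using assms(1) by (simp add: m field_simps)
  then have cos_m: "cos (of_int m * (pi / real b)) = cos (of_int r * (pi / real b))"
    by (simp add: cos_add)
  show ?thesis
  proof (cases "r \<le> int b")
    case True
    with r(1) show ?thesis
      unfolding cos_m by (rule mono)
  next
    case False
    \<comment> \<open>The reflection \<open>r\<close> to \<open>2 * b - r\<close> keeps the cosine
      and moves residues above \<open>b\<close> into the range of \<open>mono\<close>.\<close>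
    have "of_int (2 * int b - r) * (pi / real b) = 2 * pi - of_int r * (pi / real b)"
      using assms(1) by (simp add: field_simps)
    then have "cos (of_int r * (pi / real b)) = cos (of_int (2 * int b - r) * (pi / real b))"
      by (simp add: cos_diff)
    with mono[of "2 * int b - r"] False r(2) show ?thesis
      unfolding cos_m by linarith
  qed
qed

text \<open>Adding \<open>b\<close> to \<open>m\<close> shifts the angle by \<open>pi\<close> and
  negates the cosine. Since \<open>b\<close> is even, \<open>m + b\<close> stays odd, so the
  one-sided bound applies to both signs.\<close>

lemma abs_cos_odd_multiple_le_cos:
  fixes m :: int and b :: nat
  assumes "b > 0" and "even b" and "odd m"
  shows "\<bar>cos (of_int m * (pi / real b))\<bar> \<le> cos (pi / real b)"
proof -
  have *: "\<not> 2 * int b dvd n" if "odd n" for n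
    using that by (meson dvd_mult_left)
  have "of_int (m + int b) * (pi / real b) = of_int m * (pi / real b) + pi"
    using assms(1) by (simp add: field_simps)
  then have "cos (of_int (m + int b) * (pi / real b)) = - cos (of_int m * (pi / real b))"
    by simp
  with cos_multiple_le_cos[OF assms(1) *, of "m + int b"] cos_multiple_le_cos[OF assms(1) *, of m]
  show ?thesis
    using assms(2,3) by auto
qed

lemma Re_cis_mult_fourier:
  assumes "(\<lambda>i. \<bar>h i\<bar>) summable_on UNIV"
  shows "((\<lambda>i. h i * cos (\<omega> * of_int i + \<phi>)) has_sum Re (cis (- \<phi>) * fourier h \<omega>)) UNIV"
proof -
  have "(\<lambda>i. norm (complex_of_real (h i) * cis (- \<omega> * real_of_int i))) summable_on UNIV"
    using assms by (simp add: norm_mult)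
  then have "(\<lambda>i. complex_of_real (h i) * cis (- \<omega> * real_of_int i)) summable_on UNIV"
    by (rule abs_summable_summable)
  then have "((\<lambda>i. complex_of_real (h i) * cis (- \<omega> * real_of_int i)) has_sum fourier h \<omega>) UNIV"
    by (simp add: fourier_def)
  then have "((\<lambda>i. cis (- \<phi>) * (complex_of_real (h i) * cis (- \<omega> * real_of_int i)))
      has_sum (cis (- \<phi>) * fourier h \<omega>)) UNIV"
    by (rule has_sum_cmult_right)
  then have "((\<lambda>i. Re (cis (- \<phi>) * (complex_of_real (h i) * cis (- \<omega> * real_of_int i))))
      has_sum Re (cis (- \<phi>) * fourier h \<omega>)) UNIV"
    by (rule has_sum_Re)
  moreover have "Re (cis (- \<phi>) * (complex_of_real (h i) * cis (- \<omega> * real_of_int i)))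
      = h i * cos (\<omega> * of_int i + \<phi>)" for i
    by (simp add: cos_add algebra_simps)
  ultimately show ?thesis
    by simp
qed

text \<open>Summing \<open>le\<close> bounds the rotated Fourier term by the l1 norm times
  \<open>cos \<phi>\<close>, hence by \<open>cos \<phi>\<close>, which is the real part of
  \<open>cis (- \<phi>)\<close>.\<close>

lemma Re_cis_mult_multiplier_nonneg:
  assumes h: "l1_norm_le_1 h" and "cos \<phi> \<ge> 0"
    and le: "\<And>i. h i * cos (\<omega> * of_int i + \<phi>) \<le> \<bar>h i\<bar> * cos \<phi>"
  shows "Re (cis (- \<phi>) * (1 - fourier h \<omega>)) \<ge> 0"
proof -
  have summable: "(\<lambda>i. \<bar>h i\<bar>) summable_on UNIV" and norm: "(\<Sum>\<^sub>\<infinity>i. \<bar>h i\<bar>) \<le> 1"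
    using h by (auto simp: l1_norm_le_1_def)
  have "((\<lambda>i. \<bar>h i\<bar> * cos \<phi>) has_sum ((\<Sum>\<^sub>\<infinity>i. \<bar>h i\<bar>) * cos \<phi>)) UNIV"
    by (intro has_sum_cmult_left has_sum_infsum summable)
  with Re_cis_mult_fourier[OF summable]
  have "Re (cis (- \<phi>) * fourier h \<omega>) \<le> (\<Sum>\<^sub>\<infinity>i. \<bar>h i\<bar>) * cos \<phi>"
    using le by (rule has_sum_mono)
  also have "\<dots> \<le> cos \<phi>"
    using mult_right_mono[OF norm \<open>cos \<phi> \<ge> 0\<close>] by simp
  finally show ?thesis
    by (simp add: right_diff_distrib)
qed

text \<open>The reciprocal of \<open>psi\<close> is \<open>-(R + |I| cot \<theta>)\<close>, so
  adding it cancels the real part of \<open>G\<close>. What remains has real part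
  \<open>-|I| cot \<theta>\<close> and imaginary part \<open>Im G\<close>, a vector of length
  \<open>c = |I| / sin \<theta>\<close>. The bound on \<open>b\<close> keeps \<theta> below
  \<open>pi / 2\<close>.\<close>

lemma add_inverse_psi:
  assumes "b \<ge> 3" and "psi G \<omega> b > 0"
  obtains s :: int and c :: real where "\<bar>s\<bar> = 1" and "c \<ge> 0"
    and "G (cis \<omega>) + 1 / complex_of_real (psi G \<omega> b) = - of_real c * cis (- (of_int s * (pi / real b)))"
proof -
  define \<theta> where "\<theta> = pi / real b"
  define s :: int where "s = (if Im (G (cis \<omega>)) \<ge> 0 then 1 else - 1)"
  define c where "c = \<bar>Im (G (cis \<omega>))\<bar> / sin \<theta>"
  have "0 < \<theta>" "\<theta> < pi / 2"
    using assms(1) by (auto simp: \<theta>_def field_simps)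
  then have sin: "sin \<theta> > 0" and cos: "cos \<theta> > 0"
    by (auto intro: sin_gt_zero cos_gt_zero)
  have tan: "tan \<theta> = sin \<theta> / cos \<theta>"
    by (simp add: tan_def)
  have "1 / psi G \<omega> b = - (Re (G (cis \<omega>)) + \<bar>Im (G (cis \<omega>))\<bar> * cos \<theta> / sin \<theta>)"
    using sin cos by (simp add: psi_def flip: \<theta>_def) (simp add: tan field_simps)
  then have inv: "1 / complex_of_real (psi G \<omega> b) =
      of_real (- (Re (G (cis \<omega>)) + \<bar>Im (G (cis \<omega>))\<bar> * cos \<theta> / sin \<theta>))"
    by (metis of_real_1 of_real_divide)
  have "G (cis \<omega>) + 1 / complex_of_real (psi G \<omega> b) = - of_real c * cis (- (of_int s * \<theta>))"
    unfolding inv using sin by (auto simp: complex_eq_iff c_def s_def)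
  then show thesis
    using that[of s c] sin by (auto simp: s_def c_def \<theta>_def)
qed

text \<open>Common core of both parts: only the termwise bound \<open>le\<close> depends on the
  multiplier class and on \<open>b\<close>. It is required for both signs of \<open>s\<close>
  because the sign of \<open>Im G\<close> is unknown.\<close>

lemma frequency_condition_fails:
  assumes "b \<ge> 3" and "psi G \<omega> b > 0" and "l1_norm_le_1 h" and "M (cis \<omega>) = 1 - fourier h \<omega>"
    and le: "\<And>s i. \<bar>s\<bar> = 1 \<Longrightarrow>
      h i * cos (\<omega> * of_int i + of_int s * (pi / real b)) \<le> \<bar>h i\<bar> * cos (pi / real b)"
  shows "Re (M (cis \<omega>) * (G (cis \<omega>) + 1 / complex_of_real (psi G \<omega> b))) \<le> 0"
proof -
  obtain s :: int and c where s: "\<bar>s\<bar> = 1" and c: "c \<ge> 0" and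
    eq: "G (cis \<omega>) + 1 / complex_of_real (psi G \<omega> b) = - of_real c * cis (- (of_int s * (pi / real b)))"
    using add_inverse_psi[OF assms(1,2)] .
  from s have "s = 1 \<or> s = - 1"
    by linarith
  then have cos_s: "cos (of_int s * (pi / real b)) = cos (pi / real b)"
    by auto
  have "cos (pi / real b) \<ge> 0"
    using assms(1) by (intro cos_ge_zero) (auto simp: field_simps intro: order_trans[of _ 0])
  with le[OF s] cos_s have "0 \<le> Re (cis (- (of_int s * (pi / real b))) * (1 - fourier h \<omega>))"
    by (intro Re_cis_mult_multiplier_nonneg assms(3)) auto
  then have "0 \<le> c * Re (cis (- (of_int s * (pi / real b))) * M (cis \<omega>))"
    using c assms(4) by simp
  also have "\<dots> = - Re (M (cis \<omega>) * (G (cis \<omega>) + 1 / complex_of_real (psi G \<omega> b)))"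
    by (simp add: eq algebra_simps)
  finally show ?thesis
    by simp
qed

theorem proposition2:
  fixes G :: "complex \<Rightarrow> complex" and \<alpha> \<beta> :: nat and \<omega>\<^sub>1 :: real
  assumes "G \<in> RH_inf"
    and "\<alpha> > 0" and "\<beta> > 0" and "gcd \<alpha> \<beta> = 1" and "\<alpha> < \<beta>"
    and "\<omega>\<^sub>1 = real \<alpha> / real \<beta> * pi"
  shows "(\<forall>k. k = (if odd \<alpha> then psi G \<omega>\<^sub>1 (2 * \<beta>) else psi G \<omega>\<^sub>1 \<beta>) \<and> k > 0 \<longrightarrow>
            \<not> (\<exists>M\<in>ZF. \<forall>\<omega>\<in>{0..pi}.
                  Re (M (cis \<omega>) * (G (cis \<omega>) + 1 / complex_of_real k)) > 0)) \<and>
         (\<forall>k. k = psi G \<omega>\<^sub>1 (2 * \<beta>) \<and> k > 0 \<longrightarrow>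
            \<not> (\<exists>M\<in>ZF_odd. \<forall>\<omega>\<in>{0..pi}.
                  Re (M (cis \<omega>) * (G (cis \<omega>) + 1 / complex_of_real k)) > 0))"
proof -
  have \<omega>\<^sub>1: "\<omega>\<^sub>1 \<in> {0..pi}"
    using assms(3,5) by (simp add: assms(6) pos_divide_le_eq)
  have fail_odd: "Re (M (cis \<omega>\<^sub>1) * (G (cis \<omega>\<^sub>1) + 1 / complex_of_real (psi G \<omega>\<^sub>1 (2 * \<beta>)))) \<le> 0"
    if M: "M \<in> ZF_odd" and pos: "psi G \<omega>\<^sub>1 (2 * \<beta>) > 0" for M
  proof -
    from M obtain h where h: "l1_norm_le_1 h" "M (cis \<omega>\<^sub>1) = 1 - fourier h \<omega>\<^sub>1"
      by (auto simp: ZF_odd_def)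
    show ?thesis
    proof (rule frequency_condition_fails[where M = M, OF _ pos h])
      show "2 * \<beta> \<ge> 3"
        using assms(2,5) by simp
      fix s i :: int assume "\<bar>s\<bar> = 1"
      \<comment> \<open>In units of \<open>pi / (2 * \<beta>)\<close> the frequency is
        \<open>2 * \<alpha>\<close>, which is even whatever the parity of \<alpha>.\<close>
      then have "odd (2 * int \<alpha> * i + s)"
        by (auto simp: abs_if split: if_splits)
      then have "\<bar>cos (of_int (2 * int \<alpha> * i + s) * (pi / real (2 * \<beta>)))\<bar> \<le> cos (pi / real (2 * \<beta>))"
        using assms(3) by (intro abs_cos_odd_multiple_le_cos) auto
      moreover have "of_int (2 * int \<alpha> * i + s) * (pi / real (2 * \<beta>)) =
          \<omega>\<^sub>1 * of_int i + of_int s * (pi / real (2 * \<beta>))"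
        using assms(3,6) by (simp add: field_simps)
      ultimately have "\<bar>h i * cos (\<omega>\<^sub>1 * of_int i + of_int s * (pi / real (2 * \<beta>)))\<bar>
          \<le> \<bar>h i\<bar> * cos (pi / real (2 * \<beta>))"
        by (metis abs_ge_zero abs_mult mult_left_mono)
      then show "h i * cos (\<omega>\<^sub>1 * of_int i + of_int s * (pi / real (2 * \<beta>)))
          \<le> \<bar>h i\<bar> * cos (pi / real (2 * \<beta>))"
        by linarith
    qed
  qed
  have fail_even: "Re (M (cis \<omega>\<^sub>1) * (G (cis \<omega>\<^sub>1) + 1 / complex_of_real (psi G \<omega>\<^sub>1 \<beta>))) \<le> 0"
    if M: "M \<in> ZF" and pos: "psi G \<omega>\<^sub>1 \<beta> > 0" and "even \<alpha>" for M
  proof -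
    from M obtain h where nonneg: "\<And>i. h i \<ge> 0"
      and h: "l1_norm_le_1 h" "M (cis \<omega>\<^sub>1) = 1 - fourier h \<omega>\<^sub>1"
      by (auto simp: ZF_def)
    show ?thesis
    proof (rule frequency_condition_fails[where M = M, OF _ pos h])
      \<comment> \<open>A positive even \<alpha> is at least 2, and \<beta> exceeds it.\<close>
      show "\<beta> \<ge> 3"
        using assms(2,5) \<open>even \<alpha>\<close> by (auto elim!: evenE)
      fix s i :: int assume "\<bar>s\<bar> = 1"
      \<comment> \<open>Here the unit is \<open>pi / \<beta>\<close> and evenness of \<alpha> gives
        the parity. As \<beta> is odd by coprimality, the cosine can reach -1, so only a one-sided
        bound holds and \<open>nonneg\<close> is needed below.\<close>
      then have "odd (int \<alpha> * i + s)"
        using \<open>even \<alpha>\<close> by (auto simp: abs_if split: if_splits)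
      then have "\<not> 2 * int \<beta> dvd int \<alpha> * i + s"
        by (meson dvd_mult_left)
      then have "cos (of_int (int \<alpha> * i + s) * (pi / real \<beta>)) \<le> cos (pi / real \<beta>)"
        using assms(3) by (intro cos_multiple_le_cos)
      moreover have "of_int (int \<alpha> * i + s) * (pi / real \<beta>) =
          \<omega>\<^sub>1 * of_int i + of_int s * (pi / real \<beta>)"
        using assms(3,6) by (simp add: field_simps)
      ultimately show "h i * cos (\<omega>\<^sub>1 * of_int i + of_int s * (pi / real \<beta>))
          \<le> \<bar>h i\<bar> * cos (pi / real \<beta>)"
        using nonneg[of i] by (simp add: mult_left_mono)
    qed
  qed
  \<comment> \<open>For odd \<alpha> both parts use the same gain, so the inclusion reduces that
    case to \<open>fail_odd\<close>.\<close>
  have "ZF \<subseteq> ZF_odd"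
    by (auto simp: ZF_def ZF_odd_def)
  show ?thesis
  proof (intro conjI allI impI notI; elim conjE bexE)
    fix k M
    assume k: "k = (if odd \<alpha> then psi G \<omega>\<^sub>1 (2 * \<beta>) else psi G \<omega>\<^sub>1 \<beta>)" "k > 0" and M: "M \<in> ZF"
      and pos: "\<forall>\<omega>\<in>{0..pi}. Re (M (cis \<omega>) * (G (cis \<omega>) + 1 / complex_of_real k)) > 0"
    have "Re (M (cis \<omega>\<^sub>1) * (G (cis \<omega>\<^sub>1) + 1 / complex_of_real k)) \<le> 0"
      using k M \<open>ZF \<subseteq> ZF_odd\<close> fail_odd[of M] fail_even[of M] by (cases "odd \<alpha>") auto
    with bspec[OF pos \<omega>\<^sub>1] show False
      by linarith
  next
    fix k M
    assume k: "k = psi G \<omega>\<^sub>1 (2 * \<beta>)" "k > 0" and M: "M \<in> ZF_odd"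
      and pos: "\<forall>\<omega>\<in>{0..pi}. Re (M (cis \<omega>) * (G (cis \<omega>) + 1 / complex_of_real k)) > 0"
    have "Re (M (cis \<omega>\<^sub>1) * (G (cis \<omega>\<^sub>1) + 1 / complex_of_real k)) \<le> 0"
      using k fail_odd[OF M] by blast
    with bspec[OF pos \<omega>\<^sub>1] show False
      by linarith
  qed
qed

end
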